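(* Let $p$ be a prime. For any positive integer $r$, \[ F_{p^r}(x)\equiv \tilde{F}_{p^r}(x)\equiv x^{p^r}\pmod p . \]
   Context: $T_n(x)$ is the Chebyshev polynomial of the first kind: $T_0=1$, $T_1=x$, $T_n=2xT_{n-1}-T_{n-2}$ for $n\ge2$. For a positive integer $n$, $F_n(x)=2T_n\left(\frac{x}{2}+1\right)-2$ (a polynomial with integer coefficients) and $\tilde F_n(x)=(x+1)^n-1$. Congruence modulo $p$ is coefficientwise in $\mathbb{Z}[x]$. *)

theory Defs
  imports "HOL-Computational_Algebra.Computational_Algebra" "HOL-Number_Theory.Cong"
begin

fun chebyshev_T :: "nat \<Rightarrow> 'a::comm_ring_1 poly" where
  "chebyshev_T 0 = 1"
| "chebyshev_T (Suc 0) = [:0, 1:]"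
| "chebyshev_T (Suc (Suc n)) = 2 * [:0, 1:] * chebyshev_T (Suc n) - chebyshev_T n"

text \<open>The substitution \<open>x \<mapsto> x/2 + 1\<close> takes place over the rationals.\<close>

definition F_rat :: "nat \<Rightarrow> rat poly" where
  "F_rat n = 2 * pcompose (chebyshev_T n) [:1, 1/2:] - 2"

text \<open>\<open>F n\<close> is \<open>F_rat n\<close> regarded as an element of \<open>\<int>[x]\<close>; the description is proper
  by \<open>F_rat_integral\<close> below.\<close>

definition F :: "nat \<Rightarrow> int poly" where
  "F n = (THE P. map_poly rat_of_int P = F_rat n)"

definition F_tilde :: "nat \<Rightarrow> int poly" where
  "F_tilde n = [:1, 1:] ^ n - 1"

definition poly_cong :: "int poly \<Rightarrow> int poly \<Rightarrow> nat \<Rightarrow> bool" where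
  "poly_cong P Q m \<longleftrightarrow> (\<forall>i. [coeff P i = coeff Q i] (mod int m))"

lemma F_rat_rec:
  "F_rat (Suc (Suc n)) = [:2, 1:] * F_rat (Suc n) - F_rat n + [:0, 2:]"
proof -
  have X: "pcompose (2 * [:0, 1:]) [:1, 1/2:] = ([:2, 1:] :: rat poly)"
    by (simp add: pcompose_mult pcompose_pCons numeral_poly)
  have "F_rat (Suc (Suc n)) =
      2 * ([:2, 1:] * pcompose (chebyshev_T (Suc n)) [:1, 1/2:] - pcompose (chebyshev_T n) [:1, 1/2:]) - 2"
    unfolding F_rat_def chebyshev_T.simps pcompose_diff pcompose_mult[of "2 * [:0, 1:]"] X ..
  also have "[:0, 2:] = [:2, 1:] * 2 - (2 :: rat poly) * 2"
    by (simp add: numeral_poly)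
  ultimately show ?thesis
    unfolding F_rat_def by (simp add: algebra_simps)
qed

lemma F_rat_integral: "\<exists>!P. map_poly rat_of_int P = F_rat n"
proof -
  have "\<exists>P. map_poly rat_of_int P = F_rat n"
  proof (induction n rule: chebyshev_T.induct)
    case 1
    have "map_poly rat_of_int 0 = F_rat 0" by (simp add: F_rat_def pcompose_1)
    then show ?case ..
  next
    case 2
    have "map_poly rat_of_int [:0, 1:] = F_rat (Suc 0)"
      by (simp add: F_rat_def pcompose_pCons numeral_poly map_poly_pCons)
    then show ?case ..
  next
    case (3 n)
    then obtain P Q where "map_poly rat_of_int P = F_rat (Suc n)" "map_poly rat_of_int Q = F_rat n"
      by blast
    then have "map_poly rat_of_int ([:2, 1:] * P - Q + [:0, 2:]) = F_rat (Suc (Suc n))"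
      unfolding F_rat_rec
      by (intro poly_eqI)
        (auto simp: coeff_map_poly coeff_pCons poly_eq_iff split: nat.split)
    then show ?case ..
  qed
  moreover have "P = Q" if "map_poly rat_of_int P = map_poly rat_of_int Q" for P Q
    using that by (auto simp: poly_eq_iff coeff_map_poly)
  ultimately show ?thesis by metis
qed

lemma map_poly_F: "map_poly rat_of_int (F n) = F_rat n"
  unfolding F_def by (rule theI'[OF F_rat_integral])

end

theory Submission
  imports Defs
begin

text \<open>For \<open>n = p ^ r\<close> the derivatives of both polynomials are divisible by \<open>n\<close>, so \<open>n\<close> divides
  \<open>k * c\<close>, where \<open>c\<close> is the coefficient of \<open>x ^ k\<close>. For \<open>0 < k < n\<close> this forces \<open>p\<close> to divide \<open>c\<close>.
  Both polynomials are monic of degree \<open>n\<close> without constant term, so only \<open>x ^ n\<close> survives.\<close>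

text \<open>If \<open>p\<close> did not divide \<open>c\<close>, then \<open>p ^ r\<close> would be
  coprime to \<open>c\<close> and hence divide \<open>k\<close>, which is positive and too
  small.\<close>

lemma prime_power_dvd_mult_imp_dvd:
  fixes c :: int
  assumes "prime p" "0 < k" "k < p ^ r" "int (p ^ r) dvd int k * c"
  shows "int p dvd c"
proof (rule ccontr)
  assume "\<not> int p dvd c"
  then have "coprime (int (p ^ r)) c"
    using assms(1) by (simp add: prime_imp_coprime)
  then have "p ^ r dvd k"
    using assms(4) by (metis coprime_dvd_mult_left_iff int_dvd_int_iff)
  with assms(2,3) show False
    by (auto dest: dvd_imp_le)
qed

lemma poly_cong_monom_prime_power:
  assumes "prime p"
    and deg: "degree P \<le> p ^ r" and lead: "coeff P (p ^ r) = 1" and const: "coeff P 0 = 0"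
    and deriv: "pderiv P = smult (int (p ^ r)) S"
  shows "poly_cong P (monom 1 (p ^ r)) p"
  unfolding poly_cong_def
proof
  fix i
  consider "i = 0" | "i = p ^ r" | "i > p ^ r" | "0 < i" "i < p ^ r" by linarith
  then show "[coeff P i = coeff (monom 1 (p ^ r)) i] (mod int p)"
  proof cases
    case 1
    with const \<open>prime p\<close> show ?thesis by (simp add: prime_gt_0_nat)
  next
    case 2
    with lead show ?thesis by simp
  next
    case 3
    with deg show ?thesis by (simp add: coeff_eq_0)
  next
    case 4
    have "coeff (pderiv P) (i - 1) = int i * coeff P i"
      using \<open>0 < i\<close> by (simp add: coeff_pderiv)
    then have "int (p ^ r) dvd int i * coeff P i"
      unfolding deriv by (metis coeff_smult dvd_triv_left)
    then have "int p dvd coeff P i"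
      using prime_power_dvd_mult_imp_dvd[OF \<open>prime p\<close>] 4 by blast
    with 4 show ?thesis by (simp add: cong_0_iff)
  qed
qed

text \<open>By uniqueness of the integral lift, \<open>F n\<close> can be computed by checking a
  candidate over the rationals.\<close>

lemma F_eqI: "map_poly rat_of_int P = F_rat n \<Longrightarrow> F n = P"
  using F_rat_integral map_poly_F by blast

lemma F_0: "F 0 = 0"
  by (rule F_eqI) (simp add: F_rat_def pcompose_1)

lemma F_Suc_0: "F (Suc 0) = [:0, 1:]"
  by (rule F_eqI) (simp add: F_rat_def pcompose_pCons numeral_poly map_poly_pCons)

text \<open>\<open>F n + 2\<close>, that is 2 T_n(x/2 + 1), obeys the homogeneous recurrence with
  factor x + 2; the shift by 2 leaves 2(x + 2) - 2 - 2 = 2x.\<close>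

lemma F_Suc_Suc: "F (Suc (Suc n)) = [:2, 1:] * F (Suc n) - F n + [:0, 2:]"
  by (rule F_eqI, subst F_rat_rec, unfold map_poly_F[symmetric], rule poly_eqI)
    (auto simp: coeff_map_poly coeff_pCons split: nat.split)

lemma coeff_0_F: "coeff (F n) 0 = 0"
  by (induction n rule: chebyshev_T.induct) (simp_all add: F_0 F_Suc_0 F_Suc_Suc)

lemma degree_F_le: "degree (F n) \<le> n"
proof (induction n rule: chebyshev_T.induct)
  case (3 n)
  have "degree ([:2, 1:] * F (Suc n)) \<le> Suc (Suc n)"
    using degree_mult_le[of "[:2, 1:]" "F (Suc n)"] 3 by simp
  then show ?case
    unfolding F_Suc_Suc using 3 by (intro degree_add_le degree_diff_le) auto
qed (simp_all add: F_0 F_Suc_0)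

lemma coeff_F_self: "n > 0 \<Longrightarrow> coeff (F n) n = 1"
proof (induction n rule: chebyshev_T.induct)
  case (3 n)
  have "coeff (F (Suc n)) (Suc (Suc n)) = 0" "coeff (F n) (Suc (Suc n)) = 0"
    using degree_F_le[of n] degree_F_le[of "Suc n"] by (simp_all add: coeff_eq_0)
  with 3 show ?case by (simp add: F_Suc_Suc)
qed (simp_all add: F_Suc_0)

text \<open>\<open>second_kind (n + 1)\<close> is \<open>U\<^sub>n (x / 2 + 1)\<close>, with \<open>U\<^sub>n\<close> the Chebyshev polynomial of the second kind.\<close>

fun second_kind :: "nat \<Rightarrow> int poly" where
  "second_kind 0 = 0"
| "second_kind (Suc 0) = 1"
| "second_kind (Suc (Suc n)) = [:2, 1:] * second_kind (Suc n) - second_kind n"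

text \<open>The identity 2 T_m = U_m - U_(m-2) at x/2 + 1, with m = n + 1; for n = 0,
  \<open>second_kind 0\<close> stands for U_(-1) = 0.\<close>

lemma F_eq_second_kind: "F (Suc n) + 2 = second_kind (Suc (Suc n)) - second_kind n"
proof (induction n rule: chebyshev_T.induct)
  case 1
  show ?case by (simp add: F_Suc_0 numeral_poly)
next
  case 2
  show ?case by (simp add: F_Suc_Suc F_Suc_0 F_0 numeral_poly one_pCons)
next
  case (3 n)
  have "F (Suc (Suc (Suc n))) + 2 = [:2, 1:] * (F (Suc (Suc n)) + 2) - (F (Suc n) + 2)"
    by (simp add: F_Suc_Suc[of "Suc n"] algebra_simps numeral_poly)
  also have "\<dots> = second_kind (Suc (Suc (Suc (Suc n)))) - second_kind (Suc (Suc n))"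
    unfolding 3 by (simp add: algebra_simps)
  finally show ?case .
qed

text \<open>This is T_n' = n U_(n-1): the factor 2 in \<open>F\<close> cancels the 1/2 from the
  chain rule.\<close>

lemma pderiv_F: "pderiv (F n) = smult (int n) (second_kind n)"
proof (induction n rule: chebyshev_T.induct)
  case (3 n)
  have smult_int: "smult (int m) Q = of_nat m * Q" for m Q
    by (simp add: of_nat_poly)
  have "pderiv (F (Suc (Suc n))) = F (Suc n) + 2 + [:2, 1:] * pderiv (F (Suc n)) - pderiv (F n)"
    by (simp add: F_Suc_Suc pderiv_add pderiv_diff pderiv_mult pderiv_pCons numeral_poly
        del: mult_pCons_left)
  \<comment> \<open>With s for \<open>second_kind\<close>: s_(n+2) - s_n + (n+1)(x+2) s_(n+1) - n
    s_n = s_(n+2) + (n+1) s_(n+2).\<close>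
  also have "\<dots> = smult (int (Suc (Suc n))) (second_kind (Suc (Suc n)))"
    unfolding F_eq_second_kind 3 smult_int
    by (simp add: algebra_simps del: mult_pCons_left mult_pCons_right)
  finally show ?case .
qed (simp_all add: F_0 F_Suc_0 pderiv_pCons)

lemma F_tilde_prime_power_cong:
  assumes "prime p"
  shows "poly_cong (F_tilde (p ^ r)) (monom 1 (p ^ r)) p"
proof (rule poly_cong_monom_prime_power[OF assms])
  let ?n = "p ^ r"
  have n: "?n > 0" using assms by (simp add: prime_gt_0_nat)
  have deg: "degree ([:1, 1:] ^ ?n :: int poly) = ?n"
    by (simp add: degree_power_eq)
  show "degree (F_tilde ?n) \<le> ?n"
    unfolding F_tilde_def by (intro degree_diff_le) (simp_all add: deg)
  have "lead_coeff ([:1, 1:] ^ ?n :: int poly) = 1"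
    by (simp add: lead_coeff_power)
  then show "coeff (F_tilde ?n) ?n = 1"
    using n unfolding F_tilde_def deg by simp
  show "coeff (F_tilde ?n) 0 = 0"
    by (simp add: F_tilde_def coeff_0_power)
  show "pderiv (F_tilde ?n) = smult (int ?n) ([:1, 1:] ^ (?n - 1))"
    by (simp add: F_tilde_def pderiv_diff pderiv_power pderiv_pCons)
qed

theorem corollary1p10:
  fixes p r :: nat
  assumes "prime p" and "r > 0"
  shows "poly_cong (F (p ^ r)) (F_tilde (p ^ r)) p
       \<and> poly_cong (F_tilde (p ^ r)) (monom 1 (p ^ r)) p"
proof
  \<comment> \<open>The cofactor of \<open>p ^ r\<close> in the derivative is
    \<open>second_kind (p ^ r)\<close>.\<close>
  have "poly_cong (F (p ^ r)) (monom 1 (p ^ r)) p"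
    using assms(1)
    by (intro poly_cong_monom_prime_power[OF _ degree_F_le coeff_F_self coeff_0_F pderiv_F])
      (simp_all add: prime_gt_0_nat)
  then show "poly_cong (F (p ^ r)) (F_tilde (p ^ r)) p"
    using F_tilde_prime_power_cong[OF assms(1), of r]
    unfolding poly_cong_def by (blast intro: cong_sym cong_trans)
  show "poly_cong (F_tilde (p ^ r)) (monom 1 (p ^ r)) p"
    using assms(1) by (rule F_tilde_prime_power_cong)
qed

end
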